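(* Let $1\le l\le q$. For $(z,t)\in\Omega_1\times B_{q^q}$, \[ \mathbb{E}(z,t)^l=\sum_{c\in A_+}c(t)^l\,u_c(z)^l . \]
   Context: $q$ prime power, $A=\mathbb{F}_q[\theta]$, $A_+$ its monic elements, $|a|=q^{\deg_\theta a}$, $K_\infty$ the completion of $\mathbb{F}_q(\theta)$, $\mathbb{C}_\infty$ the completion of an algebraic closure of $K_\infty$, $\Omega=\mathbb{C}_\infty\setminus K_\infty$, $B_r=\{t\in\mathbb{C}_\infty:|t|<r\}$, $|z|_i=\inf_{x\in K_\infty}|z-x|$, $\Omega_1=\{z\in\Omega:|z|_i>1\}$. For $a\in A$, $a(t)$ is $a$ evaluated at $\theta=t$. $\tilde\pi A$ is the period lattice of the Carlitz module with exponential $e_{\tilde\pi A}$, and $u_c(z)=1/e_{\tilde\pi A}(\tilde\pi cz)$. $\mathbb{E}$ is Pellarin's deformation of Gekeler's false Eisenstein series $E=\sum_{c\in A_+}cu_c$; for $|t|<q^q$ it is given by the series $\mathbb{E}(z,t)=\sum_{c\in A_+}c(t)\,u_c(z)$ (it equals, up to sign, $h\,d_2^{(1)}$ where $h=\sum_{c\in A_+}c^qu_c$ and $d_2$ is Pellarin's deformation function). *)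

theory Defs
  imports "HOL-Analysis.Analysis" "HOL-Computational_Algebra.Polynomial"
begin

(* Setup. The type 'f is the finite field F_q, so q = CARD('f), and A is the type 'f poly. The
   type 'a plays the role of C_infty: iota embeds F_q into it and theta is the image of the
   variable. The absolute value of x is absval x = dist x 0, where dist is the metric of 'a; the
   locale C_infinity below requires dist x y = absval (x - y). (The constant norm is not used since
   its type is constrained to real normed vector spaces.) *)

definition absval :: "'a::{field,metric_space} \<Rightarrow> real"
  where "absval x = dist x 0"

(* a(t) *)
definition ev :: "('f::{field,finite} \<Rightarrow> 'a::field) \<Rightarrow> 'f poly \<Rightarrow> 'a \<Rightarrow> 'a"
  where "ev \<iota> a t = poly (map_poly \<iota> a) t"

definition A_plus :: "'f::{field,finite} poly set"
  where "A_plus = {a. lead_coeff a = 1}"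

definition rational_functions :: "('f::{field,finite} \<Rightarrow> 'a::field) \<Rightarrow> 'a \<Rightarrow> 'a set"
  where "rational_functions \<iota> \<theta> = {ev \<iota> a \<theta> / ev \<iota> b \<theta> | a b. b \<noteq> 0}"

(* As C_infty is complete, the completion of F_q(theta) is its closure inside C_infty. *)
definition K_inf :: "('f::{field,finite} \<Rightarrow> 'a::{field,complete_space}) \<Rightarrow> 'a \<Rightarrow> 'a set"
  where "K_inf \<iota> \<theta> = closure (rational_functions \<iota> \<theta>)"

definition algebraic_elements :: "'a::field set \<Rightarrow> 'a set"
  where "algebraic_elements K = {x. \<exists>p. p \<noteq> 0 \<and> (\<forall>i. coeff p i \<in> K) \<and> poly p x = 0}"

definition alg_closed_set :: "'a::field set \<Rightarrow> bool"
  where "alg_closed_set L \<longleftrightarrow>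
    (\<forall>p. (\<forall>i. coeff p i \<in> L) \<and> degree p > 0 \<longrightarrow> (\<exists>x\<in>L. poly p x = 0))"

(* C_infty, characterised up to isomorphism: a field, complete for a multiplicative ultrametric
   absolute value that restricts to q^deg on A, in which the elements algebraic over K_infty
   form an algebraic closure of K_infty and are dense. The normalisation of the absolute value
   on A follows from absval theta = q. *)
locale C_infinity =
  fixes \<iota> :: "'f::{field,finite} \<Rightarrow> 'a::{field,complete_space}"
    and \<theta> :: 'a
  assumes iota_one: "\<iota> 1 = 1"
    and iota_add: "\<And>x y. \<iota> (x + y) = \<iota> x + \<iota> y"
    and iota_mult: "\<And>x y. \<iota> (x * y) = \<iota> x * \<iota> y"
    and dist_absval: "\<And>x y :: 'a. dist x y = absval (x - y)"
    and absval_mult: "\<And>x y :: 'a. absval (x * y) = absval x * absval y"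
    and absval_ultrametric: "\<And>x y :: 'a. absval (x + y) \<le> max (absval x) (absval y)"
    and absval_theta: "absval \<theta> = real CARD('f)"
    and closure_alg_closed: "alg_closed_set (algebraic_elements (K_inf \<iota> \<theta>))"
    and closure_dense: "closure (algebraic_elements (K_inf \<iota> \<theta>)) = UNIV"

(* |z|_i *)
definition imag_abs ::
  "('f::{field,finite} \<Rightarrow> 'a::{field,complete_space}) \<Rightarrow> 'a \<Rightarrow> 'a \<Rightarrow> real"
  where "imag_abs \<iota> \<theta> z = (INF x\<in>K_inf \<iota> \<theta>. absval (z - x))"

definition Omega :: "('f::{field,finite} \<Rightarrow> 'a::{field,complete_space}) \<Rightarrow> 'a \<Rightarrow> 'a set"
  where "Omega \<iota> \<theta> = UNIV - K_inf \<iota> \<theta>"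

definition Omega1 :: "('f::{field,finite} \<Rightarrow> 'a::{field,complete_space}) \<Rightarrow> 'a \<Rightarrow> 'a set"
  where "Omega1 \<iota> \<theta> = {z \<in> Omega \<iota> \<theta>. imag_abs \<iota> \<theta> z > 1}"

(* The exponential of a lattice: z times the product of 1 - z/l over the nonzero l in the lattice,
   the product being the limit of the finite subproducts along the net of finite subsets. *)
definition lattice_exp :: "'a::{field,t2_space} set \<Rightarrow> 'a \<Rightarrow> 'a"
  where "lattice_exp \<Lambda> z =
    z * Lim (finite_subsets_at_top (\<Lambda> - {0})) (\<lambda>F. \<Prod>l\<in>F. 1 - z / l)"

definition scaled_A :: "('f::{field,finite} \<Rightarrow> 'a::field) \<Rightarrow> 'a \<Rightarrow> 'a \<Rightarrow> 'a set"
  where "scaled_A \<iota> \<theta> \<pi> = {\<pi> * ev \<iota> a \<theta> | a. True}"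

(* The Carlitz module: the F_q-algebra homomorphism from A to F_q-linear maps with
   theta acting as x |-> theta * x + x^q. *)
definition carlitz_module ::
  "('f::{field,finite} \<Rightarrow> 'a::field) \<Rightarrow> 'a \<Rightarrow> 'f poly \<Rightarrow> 'a \<Rightarrow> 'a"
  where "carlitz_module \<iota> \<theta> a x =
    (\<Sum>i\<le>degree a. \<iota> (coeff a i) * ((\<lambda>y. \<theta> * y + y ^ CARD('f)) ^^ i) x)"

(* pi generates the period lattice of the Carlitz module: the Drinfeld module uniformised by the
   lattice pi A is the Carlitz module. Such pi is unique up to a factor in F_q^*. *)
definition carlitz_period ::
  "('f::{field,finite} \<Rightarrow> 'a::{field,complete_space}) \<Rightarrow> 'a \<Rightarrow> 'a \<Rightarrow> bool"
  where "carlitz_period \<iota> \<theta> \<pi> \<longleftrightarrow> \<pi> \<noteq> 0 \<and>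
    (\<forall>a z. lattice_exp (scaled_A \<iota> \<theta> \<pi>) (ev \<iota> a \<theta> * z) =
       carlitz_module \<iota> \<theta> a (lattice_exp (scaled_A \<iota> \<theta> \<pi>) z))"

definition u ::
  "('f::{field,finite} \<Rightarrow> 'a::{field,complete_space}) \<Rightarrow> 'a \<Rightarrow> 'a \<Rightarrow> 'f poly \<Rightarrow> 'a \<Rightarrow> 'a"
  where "u \<iota> \<theta> \<pi> c z = 1 / lattice_exp (scaled_A \<iota> \<theta> \<pi>) (\<pi> * ev \<iota> c \<theta> * z)"

(* Pellarin's deformation of the false Eisenstein series, given by its series expansion,
   which represents it for absval t < q^q. *)
definition deformed_E ::
  "('f::{field,finite} \<Rightarrow> 'a::{field,complete_space}) \<Rightarrow> 'a \<Rightarrow> 'a \<Rightarrow> 'a \<Rightarrow> 'a \<Rightarrow> 'a"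
  where "deformed_E \<iota> \<theta> \<pi> z t = (\<Sum>\<^sub>\<infinity>c\<in>A_plus. ev \<iota> c t * u \<iota> \<theta> \<pi> c z)"

end

theory Submission
  imports Defs "HOL-Real_Asymp.Real_Asymp"
begin

text \<open>For a finite-dimensional \<open>\<F>\<^sub>q\<close>-space \<open>V\<close> and linear functions \<open>\<alpha>, \<beta>\<close> on \<open>V\<close> with \<open>\<beta>\<close> injective, the
  ratio \<open>\<alpha> / \<beta>\<close> is a function on the lines of \<open>V\<close>, and the sum of its \<open>l\<close>-th powers over all lines is
  the \<open>l\<close>-th power of its sum whenever \<open>1 \<le> l \<le> q\<close>. Monic polynomials of bounded degree represent such
  lines, and for \<open>\<alpha>(c) = c(t)\<close> and \<open>\<beta>(c) = C\<^sub>c(e(\<pi> z)) = e(\<pi> c z)\<close>, with \<open>C\<close> the Carlitz module, the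
  ratio is \<open>c(t) u\<^sub>c(z)\<close>. Hence the identity already holds for the partial sums over the monic
  polynomials of degree less than \<open>n\<close>. It passes to the limit because \<open>\<bar>z\<bar>\<^sub>i > 1\<close> makes \<open>\<bar>e(\<pi> c z)\<bar>\<close> grow
  doubly exponentially in the degree of \<open>c\<close>.\<close>

section \<open>Power sums over a finite field embedded in a larger field\<close>

locale finite_field_embedding =
  fixes \<iota> :: "'f::{field,finite} \<Rightarrow> 'a::field"
  assumes iota_one: "\<iota> 1 = 1"
    and iota_add: "\<iota> (x + y) = \<iota> x + \<iota> y"
    and iota_mult: "\<iota> (x * y) = \<iota> x * \<iota> y"
begin

lemma q_ge_2: "CARD('f) \<ge> 2"
proof -
  have "card {0, 1 :: 'f} \<le> CARD('f)" by (intro card_mono) auto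
  thus ?thesis by simp
qed

lemma iota_zero: "\<iota> 0 = 0"
  by (metis add.right_neutral add_left_cancel iota_add)

lemma iota_power: "\<iota> (x ^ n) = \<iota> x ^ n"
  by (induction n) (simp_all add: iota_one iota_mult)

lemma iota_of_nat: "\<iota> (of_nat n) = of_nat n"
  by (induction n) (simp_all add: iota_one iota_zero iota_add)

lemma iota_sum: "\<iota> (sum f S) = (\<Sum>x\<in>S. \<iota> (f x))"
  by (induction S rule: infinite_finite_induct) (simp_all add: iota_zero iota_add)

lemma iota_eq_0_iff: "\<iota> x = 0 \<longleftrightarrow> x = 0"
proof
  assume "\<iota> x = 0"
  show "x = 0"
  proof (rule ccontr)
    assume "x \<noteq> 0"
    hence "\<iota> x * \<iota> (inverse x) = 1" by (simp flip: iota_mult add: iota_one)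
    thus False using \<open>\<iota> x = 0\<close> by simp
  qed
qed (simp add: iota_zero)

text \<open>Multiplication by \<open>x\<close> permutes the nonzero elements, so it leaves their
  product unchanged.\<close>

lemma power_q_minus_one:
  fixes x :: 'f
  assumes "x \<noteq> 0"
  shows "x ^ (CARD('f) - 1) = 1"
proof -
  have "bij_betw ((*) x) (UNIV - {0}) (UNIV - {0})"
    by (rule bij_betwI[where g = "\<lambda>y. y / x"]) (use assms in auto)
  hence "(\<Prod>y\<in>UNIV - {0}. x * y) = \<Prod>(UNIV - {0 :: 'f})"
    by (rule prod.reindex_bij_betw)
  hence "x ^ (CARD('f) - 1) * \<Prod>(UNIV - {0 :: 'f}) = \<Prod>(UNIV - {0})"
    by (simp add: prod.distrib)
  moreover have "\<Prod>(UNIV - {0 :: 'f}) \<noteq> 0" by simp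
  ultimately show ?thesis by simp
qed

lemma power_q: "(x :: 'f) ^ CARD('f) = x"
proof (cases "x = 0")
  case False
  thus ?thesis using power_minus_mult[of "CARD('f)" x] power_q_minus_one q_ge_2 by simp
qed (use q_ge_2 in simp)

text \<open>Translation by 1 permutes the field, hence preserves the sum of all elements, which it
  also raises by q.\<close>

lemma of_nat_q: "of_nat CARD('f) = (0 :: 'a)"
proof -
  have "bij (\<lambda>y :: 'f. y + 1)"
    by (rule bij_betwI[where g = "\<lambda>y. y - 1"]) auto
  hence "(\<Sum>y\<in>UNIV. y + 1) = (\<Sum>y\<in>UNIV. y :: 'f)"
    by (rule sum.reindex_bij_betw)
  hence "of_nat CARD('f) = (0 :: 'f)" by (simp add: sum.distrib)
  thus ?thesis using iota_of_nat[of "CARD('f)"] by (simp add: iota_zero)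
qed

text \<open>The polynomial \<open>(X + 1) ^ q - X ^ q - 1\<close> has degree less than q but
  vanishes at all q elements of the field, so its coefficients are zero.\<close>

lemma of_nat_binomial_q:
  assumes "0 < k" "k < CARD('f)"
  shows "of_nat (CARD('f) choose k) = (0 :: 'a)"
proof -
  define p :: "'f poly" where "p = (\<Sum>k\<in>{0<..<CARD('f)}. monom (of_nat (CARD('f) choose k)) k)"
  have "poly p x = 0" for x
  proof -
    have "{..CARD('f)} = insert 0 (insert CARD('f) {0<..<CARD('f)})" using q_ge_2 by auto
    hence "(x + 1) ^ CARD('f) = 1 + (x ^ CARD('f) + poly p x)"
      using q_ge_2 unfolding binomial_ring by (simp add: p_def poly_sum poly_monom add_ac)
    thus ?thesis by (simp add: power_q)
  qed
  moreover have "degree p < CARD('f)"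
    unfolding p_def using q_ge_2
    by (intro degree_sum_less) (auto intro: le_less_trans[OF degree_monom_le])
  ultimately have "p = 0"
    using card_poly_roots_bound[of p] by (cases "p = 0") auto
  moreover have "coeff p k = of_nat (CARD('f) choose k)"
    using assms by (simp add: p_def coeff_sum)
  ultimately have "of_nat (CARD('f) choose k) = (0 :: 'f)" by simp
  thus ?thesis using iota_of_nat[of "CARD('f) choose k"] by (simp add: iota_zero)
qed

lemma frobenius_add: "(x + y) ^ CARD('f) = x ^ CARD('f) + (y :: 'a) ^ CARD('f)"
proof -
  have "{..CARD('f)} = insert 0 (insert CARD('f) {0<..<CARD('f)})" using q_ge_2 by auto
  moreover have "(\<Sum>k\<in>{0<..<CARD('f)}. of_nat (CARD('f) choose k) * x ^ k * y ^ (CARD('f) - k)) = 0"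
    by (intro sum.neutral) (simp add: of_nat_binomial_q)
  ultimately show ?thesis
    using q_ge_2 by (simp add: binomial_ring add_ac)
qed

text \<open>For \<open>m > 0\<close>, scaling \<open>y\<close> by \<open>v\<close> multiplies the
  sum by \<open>v ^ m\<close>, and some nonzero \<open>v\<close> has \<open>v ^ m \<noteq> 1\<close>
  because \<open>X ^ m - 1\<close> has at most \<open>m < q - 1\<close> roots. For
  \<open>m = 0\<close> the convention \<open>0 ^ 0 = 1\<close> makes the sum q, which
  vanishes.\<close>

lemma sum_iota_power:
  assumes "m < CARD('f) - 1"
  shows "(\<Sum>y\<in>UNIV. \<iota> y ^ m) = 0"
proof (cases "m = 0")
  case True
  thus ?thesis by (simp add: of_nat_q)
next
  case False
  define p :: "'f poly" where "p = monom 1 m - 1"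
  have deg: "degree p \<le> m"
    unfolding p_def by (intro degree_diff_le) (auto simp: degree_monom_le)
  have "coeff p m = 1" using False by (simp add: p_def)
  hence "p \<noteq> 0" by auto
  have "\<exists>u. u \<noteq> 0 \<and> poly p u \<noteq> 0"
  proof (rule ccontr)
    assume "\<not> ?thesis"
    hence "UNIV - {0} \<subseteq> {x. poly p x = 0}" by auto
    hence "CARD('f) - 1 \<le> card {x. poly p x = 0}"
      using card_mono[of "{x. poly p x = 0}" "UNIV - {0 :: 'f}"] by simp
    thus False using card_poly_roots_bound[OF \<open>p \<noteq> 0\<close>] deg assms by linarith
  qed
  then obtain v :: 'f where v: "v \<noteq> 0" "v ^ m \<noteq> 1" by (auto simp: p_def poly_monom)
  have "bij_betw ((*) v) UNIV UNIV"
    by (rule bij_betwI[where g = "\<lambda>y. y / v"]) (use v in auto)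
  hence "(\<Sum>y\<in>UNIV. (v * y) ^ m) = (\<Sum>y\<in>UNIV. y ^ m)"
    by (rule sum.reindex_bij_betw)
  hence "(v ^ m - 1) * (\<Sum>y\<in>UNIV. y ^ m) = 0"
    by (simp add: power_mult_distrib left_diff_distrib flip: sum_distrib_left)
  hence "(\<Sum>y\<in>UNIV. y ^ m) = (0 :: 'f)" using v by simp
  thus ?thesis by (simp flip: iota_power iota_sum add: iota_zero)
qed

lemma sum_iota_power_q_minus_one: "(\<Sum>y\<in>UNIV. \<iota> y ^ (CARD('f) - 1)) = -1"
proof -
  have "(\<Sum>y\<in>UNIV. \<iota> y ^ (CARD('f) - 1)) = (\<Sum>y\<in>UNIV - {0}. \<iota> y ^ (CARD('f) - 1))"
    by (rule sum.mono_neutral_right) (use q_ge_2 in \<open>auto simp: iota_zero\<close>)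
  also have "\<dots> = (\<Sum>y\<in>UNIV - {0 :: 'f}. 1)"
    by (intro sum.cong) (simp_all add: power_q_minus_one[unfolded One_nat_def] iota_one flip: iota_power)
  also have "\<dots> = -1"
    using q_ge_2 by (simp add: of_nat_diff of_nat_q)
  finally show ?thesis .
qed

text \<open>In the binomial expansion only the power sum with exponent q - 1 survives, and it occurs
  only as the top term for \<open>m = q - 1\<close>.\<close>

lemma sum_shift_power:
  assumes "m \<le> CARD('f) - 1"
  shows "(\<Sum>y\<in>UNIV. (B + \<iota> y) ^ m) = (if m = CARD('f) - 1 then - 1 else 0)"
proof -
  have "(\<Sum>y\<in>UNIV. (B + \<iota> y) ^ m)
      = (\<Sum>y\<in>UNIV. \<Sum>k\<le>m. of_nat (m choose k) * B ^ (m - k) * \<iota> y ^ k)"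
    by (subst add.commute) (simp add: binomial_ring mult_ac)
  also have "\<dots> = (\<Sum>k\<le>m. of_nat (m choose k) * B ^ (m - k) * (\<Sum>y\<in>UNIV. \<iota> y ^ k))"
    by (subst sum.swap) (simp add: sum_distrib_left)
  also have "\<dots> = (\<Sum>k\<le>m. if k = CARD('f) - 1 then - 1 else 0)"
    using assms
    by (intro sum.cong refl) (auto simp: sum_iota_power sum_iota_power_q_minus_one[simplified])
  also have "\<dots> = (if m = CARD('f) - 1 then - 1 else 0)"
    using assms by auto
  finally show ?thesis .
qed

text \<open>For \<open>j \<le> q\<close> the \<open>j\<close>-th Goss polynomial of \<open>\<F>\<^sub>q\<close> is \<open>X ^ j\<close>; dividing
  \<open>v ^ q - v = B ^ q - B\<close> by \<open>v ^ (j + 1)\<close>, where \<open>v = B + y\<close>, and summing over \<open>y\<close> yields a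
  recursion for the power sums.\<close>
lemma sum_inverse_shift_power:
  assumes nz: "\<And>y. B + \<iota> y \<noteq> 0" and "1 \<le> j" "j \<le> CARD('f)"
  shows "B ^ CARD('f) \<noteq> B"
    and "(\<Sum>y\<in>UNIV. (1 / (B + \<iota> y)) ^ j) = (- 1 / (B ^ CARD('f) - B)) ^ j"
proof -
  define D where "D = B ^ CARD('f) - B"
  define P where "P j = (\<Sum>y\<in>UNIV. (1 / (B + \<iota> y)) ^ j)" for j
  \<comment> \<open>The map \<open>v ^ q - v\<close> is additive and kills the image of the finite
    field, so it has the same value at all \<open>B + \<iota> y\<close>.\<close>
  have D: "D = (B + \<iota> y) ^ CARD('f) - (B + \<iota> y)" for y
    by (simp add: D_def frobenius_add power_q flip: iota_power)
  have rec: "P (Suc k) * D = (if k = 0 then -1 else 0) - P k" if "k \<le> CARD('f) - 1" for k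
  proof -
    have "(1 / (B + \<iota> y)) ^ Suc k * D = (B + \<iota> y) ^ (CARD('f) - 1 - k) - (1 / (B + \<iota> y)) ^ k" for y
    proof -
      define v where "v = B + \<iota> y"
      have exponent: "CARD('f) - 1 - k + Suc k = CARD('f)" using that q_ge_2 by simp
      have "v ^ CARD('f) = v ^ (CARD('f) - 1 - k) * v ^ Suc k"
        using power_add[of v "CARD('f) - 1 - k" "Suc k"] unfolding exponent .
      moreover have "(1 / v) ^ Suc k * (a * v ^ Suc k - v) = a - (1 / v) ^ k" for a
        using nz[of y] by (simp add: v_def[symmetric] field_simps)
      ultimately show ?thesis using D[of y] by (simp only: v_def)
    qed
    hence "P (Suc k) * D = (\<Sum>y\<in>UNIV. (B + \<iota> y) ^ (CARD('f) - 1 - k)) - P k"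
      by (simp only: P_def sum_distrib_right sum_subtractf)
    thus ?thesis using that q_ge_2 by (auto simp: sum_shift_power)
  qed
  \<comment> \<open>\<open>P 0\<close> counts the q elements and so is 0. The resulting equation
    both shows \<open>D \<noteq> 0\<close> and starts the recursion.\<close>
  have P1: "P 1 * D = - 1" using rec[of 0] by (simp add: P_def of_nat_q)
  hence "D \<noteq> 0" by auto
  thus "B ^ CARD('f) \<noteq> B" by (simp add: D_def)
  have "P j = (- 1 / D) ^ j"
    using \<open>1 \<le> j\<close> \<open>j \<le> CARD('f)\<close>
  proof (induction j rule: dec_induct)
    case base
    show ?case using P1 \<open>D \<noteq> 0\<close> by (simp add: field_simps)
  next
    case (step k)
    hence "P (Suc k) * D = - P k" "P k = (- 1 / D) ^ k" using rec[of k] by auto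
    thus ?case using \<open>D \<noteq> 0\<close> by (simp add: field_simps)
  qed
  thus "(\<Sum>y\<in>UNIV. (1 / (B + \<iota> y)) ^ j) = (- 1 / (B ^ CARD('f) - B)) ^ j"
    by (simp add: P_def D_def)
qed

section \<open>Ratios of linear functions summed over monic polynomials\<close>

definition Fq_linear :: "('f poly \<Rightarrow> 'a) \<Rightarrow> bool"
  where "Fq_linear f \<longleftrightarrow> (\<forall>c d. f (c + d) = f c + f d) \<and> (\<forall>y c. f (smult y c) = \<iota> y * f c)"

lemma Fq_linear_pCons:
  assumes "Fq_linear f"
  shows "f (pCons y w) = f (pCons 0 w) + \<iota> y * f 1"
proof -
  have "pCons y w = pCons 0 w + smult y 1" by simp
  thus ?thesis using assms unfolding Fq_linear_def by metis
qed

definition monic_below :: "nat \<Rightarrow> 'f poly set"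
  where "monic_below n = {c. lead_coeff c = 1 \<and> degree c < n}"

lemma monic_below_0: "monic_below 0 = {}"
  by (simp add: monic_below_def)

lemma monic_below_Suc:
  "monic_below (Suc n) = insert 1 ((\<lambda>(w, y). pCons y w) ` (monic_below n \<times> UNIV))"
proof (intro equalityI subsetI)
  fix c assume c: "c \<in> monic_below (Suc n)"
  show "c \<in> insert 1 ((\<lambda>(w, y). pCons y w) ` (monic_below n \<times> UNIV))"
  proof (cases c)
    case (pCons y w)
    show ?thesis
    proof (cases "w = 0")
      case True
      thus ?thesis using c pCons by (simp add: monic_below_def one_pCons)
    next
      case False
      hence "w \<in> monic_below n" using c pCons by (simp add: monic_below_def)
      thus ?thesis using pCons by force
    qed
  qed
qed (auto simp: monic_below_def degree_pCons_eq_if)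

lemma finite_monic_below: "finite (monic_below n)"
  by (induction n) (simp_all add: monic_below_0 monic_below_Suc)

text \<open>Apart from the line of constants, represented by \<open>1\<close>, lines are grouped by
  their image modulo constants: the polynomials \<open>pCons y w\<close> represent the q lines above
  that of \<open>w\<close>.\<close>

lemma sum_monic_below_Suc:
  "sum f (monic_below (Suc n)) = f 1 + (\<Sum>w\<in>monic_below n. \<Sum>y\<in>UNIV. f (pCons y w))"
proof -
  have "1 \<notin> (\<lambda>(w, y). pCons y w) ` (monic_below n \<times> UNIV)"
    by (auto simp: one_pCons monic_below_def)
  moreover have "inj_on (\<lambda>(w, y). pCons y w) (monic_below n \<times> UNIV)"
    by (auto simp: inj_on_def)
  ultimately show ?thesis
    by (simp add: monic_below_Suc finite_monic_below sum.reindex sum.cartesian_product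
        case_prod_unfold)
qed

text \<open>The monic polynomials of degree less than \<open>n\<close> are representatives of the lines of an
  \<open>n\<close>-dimensional space \<open>V\<close> over \<open>\<F>\<^sub>q\<close>. The induction projects from the line of constants: the
  sum over a fibre is again a ratio of linear functions on \<open>V\<close> modulo constants.\<close>
theorem sum_linear_ratio_power:
  assumes "Fq_linear \<alpha>" "Fq_linear \<beta>"
    and "\<And>c. c \<noteq> 0 \<Longrightarrow> degree c < n \<Longrightarrow> \<beta> c \<noteq> 0" and "1 \<le> l" "l \<le> CARD('f)"
  shows "(\<Sum>c\<in>monic_below n. (\<alpha> c / \<beta> c) ^ l) = (\<Sum>c\<in>monic_below n. \<alpha> c / \<beta> c) ^ l"
  using assms
proof (induction n arbitrary: \<alpha> \<beta> l)
  case 0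
  thus ?case by (simp add: monic_below_0)
next
  case (Suc n)
  note lin = Suc.prems(1,2)
  define a1 b1 where "a1 = \<alpha> 1" and "b1 = \<beta> 1"
  define r where "r = a1 / b1"
  \<comment> \<open>Here \<open>w\<close> stands for the class of \<open>pCons 0 w\<close> modulo
    constants. Up to a factor, \<open>\<alpha>' w\<close> is the determinant of
    \<open>\<alpha>\<close> and \<open>\<beta>\<close> at \<open>pCons 0 w\<close> and
    \<open>1\<close>, while \<open>\<beta>' w\<close> is the product of
    \<open>\<beta> (pCons y w)\<close> over all \<open>y\<close>.\<close>
  define \<alpha>' where "\<alpha>' w = - (\<alpha> (pCons 0 w) * b1 - a1 * \<beta> (pCons 0 w)) * b1 ^ (CARD('f) - 2)" for w
  define \<beta>' where "\<beta>' w = \<beta> (pCons 0 w) ^ CARD('f) - \<beta> (pCons 0 w) * b1 ^ (CARD('f) - 1)" for w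
  have b1: "b1 \<noteq> 0" using Suc.prems(3)[of 1] by (simp add: b1_def)
  have lin0: "f (pCons 0 (c + d)) = f (pCons 0 c) + f (pCons 0 d)"
    "f (pCons 0 (smult y c)) = \<iota> y * f (pCons 0 c)" if "Fq_linear f" for f c d y
  proof -
    have "pCons 0 (c + d) = pCons 0 c + pCons 0 d" "pCons 0 (smult y c) = smult y (pCons 0 c)"
      by simp_all
    thus "f (pCons 0 (c + d)) = f (pCons 0 c) + f (pCons 0 d)"
      "f (pCons 0 (smult y c)) = \<iota> y * f (pCons 0 c)"
      using that unfolding Fq_linear_def by metis+
  qed
  have lin': "Fq_linear \<alpha>'" "Fq_linear \<beta>'"
    unfolding Fq_linear_def \<alpha>'_def \<beta>'_def lin0[OF lin(1)] lin0[OF lin(2)]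
    by (simp_all add: algebra_simps frobenius_add power_mult_distrib power_q flip: iota_power)
  have fibre: "\<beta>' w \<noteq> 0"
    "1 \<le> j \<Longrightarrow> j \<le> CARD('f) \<Longrightarrow>
      (\<Sum>y\<in>UNIV. (\<alpha> (pCons y w) / \<beta> (pCons y w)) ^ j) = (r + \<alpha>' w / \<beta>' w) ^ j - r ^ j"
    if w: "w \<noteq> 0" "degree w < n" for w j
  proof -
    \<comment> \<open>In these coordinates the ratio on the fibre is
      \<open>r + s / (B + \<iota> y)\<close>, so only inverse power sums of
      \<open>B + \<iota> y\<close> enter.\<close>
    define B where "B = \<beta> (pCons 0 w) / b1"
    define s where "s = \<alpha> (pCons 0 w) / b1 - r * B"
    have \<beta>_eq: "\<beta> (pCons y w) = b1 * (B + \<iota> y)" for y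
      using b1 by (subst Fq_linear_pCons[OF lin(2)]) (simp add: B_def field_simps flip: b1_def)
    have \<alpha>_eq: "\<alpha> (pCons y w) = b1 * (r * (B + \<iota> y) + s)" for y
      using b1 by (subst Fq_linear_pCons[OF lin(1)])
        (simp add: s_def r_def field_simps flip: a1_def)
    have nz: "B + \<iota> y \<noteq> 0" for y
      using Suc.prems(3)[of "pCons y w"] w by (auto simp: \<beta>_eq)
    have goss: "(\<Sum>y\<in>UNIV. (1 / (B + \<iota> y)) ^ j) = (- 1 / (B ^ CARD('f) - B)) ^ j"
      if "1 \<le> j" "j \<le> CARD('f)" for j
      using sum_inverse_shift_power(2)[OF nz that] .
    have "B ^ CARD('f) \<noteq> B"
      using sum_inverse_shift_power(1)[of B 1] nz q_ge_2 by simp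
    have exponents: "CARD('f) - 1 + 1 = CARD('f)" "CARD('f) - 2 + 2 = CARD('f)"
      using q_ge_2 by simp_all
    have b1q: "b1 ^ CARD('f) = b1 ^ (CARD('f) - 1) * b1"
      "b1 ^ CARD('f) = b1 ^ (CARD('f) - 2) * b1 * b1"
      using power_add[of b1 "CARD('f) - 1" 1] power_add[of b1 "CARD('f) - 2" 2]
      unfolding exponents by (simp_all only: power_one_right power2_eq_square mult.assoc)
    have \<beta>'_eq: "\<beta>' w = b1 ^ CARD('f) * (B ^ CARD('f) - B)"
      unfolding \<beta>'_def using b1 by (simp add: \<beta>_eq[of 0] iota_zero power_mult_distrib algebra_simps b1q(1))
    have \<alpha>'_eq: "\<alpha>' w = - (b1 ^ CARD('f) * s)"
      unfolding \<alpha>'_def using b1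
      by (simp add: \<alpha>_eq[of 0] \<beta>_eq[of 0] iota_zero algebra_simps b1q(2) r_def)
    show "\<beta>' w \<noteq> 0" using \<beta>'_eq b1 \<open>B ^ CARD('f) \<noteq> B\<close> by simp
    assume j: "1 \<le> j" "j \<le> CARD('f)"
    define g where "g = - 1 / (B ^ CARD('f) - B)"
    have "\<alpha>' w / \<beta>' w = s * g"
      using b1 \<open>B ^ CARD('f) \<noteq> B\<close> by (simp add: \<alpha>'_eq \<beta>'_eq g_def field_simps)
    define v where "v y = 1 / (B + \<iota> y)" for y
    have "\<alpha> (pCons y w) / \<beta> (pCons y w) = s * v y + r" for y
      using b1 nz by (simp add: \<alpha>_eq \<beta>_eq v_def add_divide_distrib add.commute)
    hence "(\<Sum>y\<in>UNIV. (\<alpha> (pCons y w) / \<beta> (pCons y w)) ^ j)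
        = (\<Sum>i\<le>j. \<Sum>y\<in>UNIV. of_nat (j choose i) * (s * v y) ^ i * r ^ (j - i))"
      by (subst sum.swap) (simp add: binomial_ring)
    also have "\<dots> = (\<Sum>i\<le>j. of_nat (j choose i) * s ^ i * r ^ (j - i) * (\<Sum>y\<in>UNIV. v y ^ i))"
      by (simp add: sum_distrib_left power_mult_distrib mult_ac)
    \<comment> \<open>The term \<open>i = 0\<close> vanishes because summing 1 over the field gives
      q = 0; this is the origin of \<open>- r ^ j\<close>.\<close>
    also have "\<dots> = (\<Sum>i\<in>{..j} - {0}. of_nat (j choose i) * s ^ i * r ^ (j - i) * g ^ i)"
    proof (intro sum.mono_neutral_cong_right)
      fix i assume "i \<in> {..j} - {0}"
      hence "(\<Sum>y\<in>UNIV. v y ^ i) = g ^ i" unfolding v_def g_def using j by (intro goss) auto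
      thus "of_nat (j choose i) * s ^ i * r ^ (j - i) * (\<Sum>y\<in>UNIV. v y ^ i)
          = of_nat (j choose i) * s ^ i * r ^ (j - i) * g ^ i" by simp
    qed (auto simp: of_nat_q)
    also have "\<dots> = (\<Sum>i\<le>j. of_nat (j choose i) * s ^ i * r ^ (j - i) * g ^ i) - r ^ j"
      by (simp add: sum.remove[of "{..j}" 0])
    also have "(\<Sum>i\<le>j. of_nat (j choose i) * s ^ i * r ^ (j - i) * g ^ i) = (s * g + r) ^ j"
      unfolding binomial_ring by (simp add: power_mult_distrib mult_ac)
    finally show "(\<Sum>y\<in>UNIV. (\<alpha> (pCons y w) / \<beta> (pCons y w)) ^ j) = (r + \<alpha>' w / \<beta>' w) ^ j - r ^ j"
      by (simp add: \<open>\<alpha>' w / \<beta>' w = s * g\<close> add_ac)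
  qed
  define E where "E = (\<Sum>w\<in>monic_below n. \<alpha>' w / \<beta>' w)"
  \<comment> \<open>The expansion uses the induction hypothesis for every exponent from 1 to
    \<open>j\<close>. The summand \<open>r ^ j\<close> coming from \<open>c = 1\<close> supplies the
    missing term \<open>i = 0\<close>.\<close>
  have total: "(\<Sum>c\<in>monic_below (Suc n). (\<alpha> c / \<beta> c) ^ j) = (r + E) ^ j"
    if j: "1 \<le> j" "j \<le> CARD('f)" for j
  proof -
    have "(\<Sum>y\<in>UNIV. (\<alpha> (pCons y w) / \<beta> (pCons y w)) ^ j) = (\<alpha>' w / \<beta>' w + r) ^ j - r ^ j"
      if "w \<in> monic_below n" for w
    proof -
      have "w \<noteq> 0" "degree w < n" using that by (auto simp: monic_below_def)
      from fibre(2)[OF this j] show ?thesis by (simp only: add.commute)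
    qed
    hence "(\<Sum>c\<in>monic_below (Suc n). (\<alpha> c / \<beta> c) ^ j)
        = r ^ j + (\<Sum>w\<in>monic_below n. (\<alpha>' w / \<beta>' w + r) ^ j - r ^ j)"
      unfolding sum_monic_below_Suc by (simp add: r_def a1_def b1_def)
    also have "(\<Sum>w\<in>monic_below n. (\<alpha>' w / \<beta>' w + r) ^ j - r ^ j)
       = (\<Sum>w\<in>monic_below n. \<Sum>i\<in>{..j} - {0}. of_nat (j choose i) * r ^ (j - i) * (\<alpha>' w / \<beta>' w) ^ i)"
      unfolding binomial_ring by (simp add: sum.remove[of "{..j}" 0] mult_ac)
    also have "\<dots> = (\<Sum>i\<in>{..j} - {0}. of_nat (j choose i) * r ^ (j - i) * (\<Sum>w\<in>monic_below n. (\<alpha>' w / \<beta>' w) ^ i))"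
      by (subst sum.swap) (simp add: sum_distrib_left)
    also have "\<dots> = (\<Sum>i\<in>{..j} - {0}. of_nat (j choose i) * r ^ (j - i) * E ^ i)"
      unfolding E_def using j lin' fibre(1)
      by (intro sum.cong refl arg_cong2[where f = "(*)"] Suc.IH) auto
    also have "r ^ j + \<dots> = (E + r) ^ j"
      unfolding binomial_ring by (simp add: sum.remove[of "{..j}" 0] mult_ac)
    finally show ?thesis by (simp add: add_ac)
  qed
  \<comment> \<open>The exponent 1 identifies \<open>r + E\<close> as the sum itself.\<close>
  from total[of l] total[of 1] Suc.prems(4,5) q_ge_2 show ?case by simp
qed

end

section \<open>Limits along the net of finite subsets\<close>

lemma convergent_finite_subsets_at_top:
  fixes s :: "'i set \<Rightarrow> 'b::complete_space"
  assumes "\<And>e. e > 0 \<Longrightarrow> \<exists>F0. finite F0 \<and> F0 \<subseteq> I \<and>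
    (\<forall>F. finite F \<longrightarrow> F0 \<subseteq> F \<longrightarrow> F \<subseteq> I \<longrightarrow> dist (s F) (s F0) < e)"
  shows "\<exists>L. (s \<longlongrightarrow> L) (finite_subsets_at_top I)"
proof -
  have "cauchy_filter (filtermap s (finite_subsets_at_top I))"
    unfolding cauchy_filter_metric_filtermap
  proof (intro allI impI)
    fix e :: real assume "e > 0"
    then obtain F0 where F0: "finite F0" "F0 \<subseteq> I"
      "\<And>F. finite F \<Longrightarrow> F0 \<subseteq> F \<Longrightarrow> F \<subseteq> I \<Longrightarrow> dist (s F) (s F0) < e / 2"
      using assms[of "e / 2"] by auto
    show "\<exists>P. eventually P (finite_subsets_at_top I) \<and>
        (\<forall>F G. P F \<and> P G \<longrightarrow> dist (s F) (s G) < e)"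
    proof (intro exI conjI allI impI)
      show "\<forall>\<^sub>F F in finite_subsets_at_top I. finite F \<and> F0 \<subseteq> F \<and> F \<subseteq> I"
        using F0 by (auto simp: eventually_finite_subsets_at_top)
      fix F G assume FG: "(finite F \<and> F0 \<subseteq> F \<and> F \<subseteq> I) \<and> (finite G \<and> F0 \<subseteq> G \<and> G \<subseteq> I)"
      have "dist (s F) (s G) \<le> dist (s F) (s F0) + dist (s G) (s F0)"
        by (rule dist_triangle2)
      also have "\<dots> < e / 2 + e / 2" using FG by (intro add_strict_mono F0) auto
      finally show "dist (s F) (s G) < e" by simp
    qed
  qed
  \<comment> \<open>Completeness for Cauchy sequences is carried over to Cauchy filters.\<close>
  moreover have "complete (UNIV :: 'b set)"
    by (meson Cauchy_convergent UNIV_I complete_def convergent_def)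
  ultimately show ?thesis
    using complete_uniform[where S = "UNIV :: 'b set"] by (force simp: filterlim_def)
qed

text \<open>Lets a limit over all finite subsets be computed along one increasing sequence of them,
  here polynomials ordered by degree, both for the lattice product and for the series.\<close>

lemma filterlim_exhaustion_finite_subsets_at_top:
  assumes "\<And>n. finite (X n)" "\<And>n. X n \<subseteq> I" "incseq X" "I \<subseteq> (\<Union>n. X n)"
  shows "filterlim X (finite_subsets_at_top I) sequentially"
  unfolding filterlim_finite_subsets_at_top
proof (intro allI impI)
  fix F assume F: "finite F \<and> F \<subseteq> I"
  have "\<forall>\<^sub>F n in sequentially. x \<in> X n" if x: "x \<in> F" for x
  proof -
    obtain N where "x \<in> X N" using x F assms(4) by auto
    thus ?thesis using \<open>incseq X\<close>
      by (auto simp: incseq_def intro!: eventually_sequentiallyI[of N])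
  qed
  hence "\<forall>\<^sub>F n in sequentially. \<forall>x\<in>F. x \<in> X n" using F by (simp add: eventually_ball_finite)
  thus "\<forall>\<^sub>F n in sequentially. finite (X n) \<and> F \<subseteq> X n \<and> X n \<subseteq> I"
    by eventually_elim (use assms in auto)
qed

section \<open>Polynomials of bounded degree, evaluation and the Carlitz action\<close>

lemma finite_degree_le: "finite {a :: 'f::{zero,finite} poly. degree a \<le> n}"
  and card_degree_le: "card {a :: 'f::{zero,finite} poly. degree a \<le> n} = CARD('f) ^ Suc n"
proof -
  have "finite {a :: 'f poly. degree a \<le> n} \<and>
      card {a :: 'f poly. degree a \<le> n} = CARD('f) ^ Suc n"
  proof (induction n)
    case 0
    have "{a :: 'f poly. degree a \<le> 0} = (\<lambda>y. [:y:]) ` UNIV"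
      by (auto elim: degree_eq_zeroE)
    moreover have "inj (\<lambda>y :: 'f. [:y:])" by (simp add: inj_def)
    ultimately show ?case by (simp add: card_image)
  next
    case (Suc n)
    have "a \<in> (\<lambda>(y, w). pCons y w) ` (UNIV \<times> {a. degree a \<le> n})"
      if "degree a \<le> Suc n" for a :: "'f poly"
      using that by (cases a) (force split: if_splits)
    hence "{a :: 'f poly. degree a \<le> Suc n} = (\<lambda>(y, w). pCons y w) ` (UNIV \<times> {a. degree a \<le> n})"
      by (auto simp: degree_pCons_eq_if)
    moreover have "inj_on (\<lambda>(y, w). pCons y w) (UNIV \<times> {a :: 'f poly. degree a \<le> n})"
      by (auto simp: inj_on_def)
    ultimately show ?case using Suc by (simp add: card_image card_cartesian_product)
  qed
  thus "finite {a :: 'f poly. degree a \<le> n}" "card {a :: 'f poly. degree a \<le> n} = CARD('f) ^ Suc n"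
    by auto
qed

context finite_field_embedding
begin

text \<open>Evaluation and the Carlitz action on a fixed \<open>x\<close> both have this form, with
  \<open>g i\<close> a power of \<open>x\<close> or the value of an iterate at \<open>x\<close>. The
  bound \<open>degree a\<close> may be enlarged, hence made common to two polynomials.\<close>

lemma Fq_linear_coeff_sum: "Fq_linear (\<lambda>a. \<Sum>i\<le>degree a. \<iota> (coeff a i) * g i)"
proof -
  have ext: "(\<Sum>i\<le>degree a. \<iota> (coeff a i) * g i) = (\<Sum>i\<le>n. \<iota> (coeff a i) * g i)"
    if "degree a \<le> n" for a n
    using that by (intro sum.mono_neutral_left) (auto simp: coeff_eq_0 iota_zero)
  show ?thesis unfolding Fq_linear_def
  proof (intro conjI allI)
    fix c d :: "'f poly"
    define n where "n = max (degree c) (degree d)"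
    have n: "degree c \<le> n" "degree d \<le> n" "degree (c + d) \<le> n"
      by (auto simp: n_def degree_add_le_max)
    show "(\<Sum>i\<le>degree (c + d). \<iota> (coeff (c + d) i) * g i) =
       (\<Sum>i\<le>degree c. \<iota> (coeff c i) * g i) + (\<Sum>i\<le>degree d. \<iota> (coeff d i) * g i)"
      unfolding ext[OF n(1)] ext[OF n(2)] ext[OF n(3)]
      by (simp add: iota_add distrib_right sum.distrib)
  next
    fix y and c :: "'f poly"
    show "(\<Sum>i\<le>degree (smult y c). \<iota> (coeff (smult y c) i) * g i) =
       \<iota> y * (\<Sum>i\<le>degree c. \<iota> (coeff c i) * g i)"
      unfolding ext[OF degree_smult_le] by (simp add: iota_mult sum_distrib_left mult.assoc)
  qed
qed

lemma ev_altdef: "ev \<iota> a x = (\<Sum>i\<le>degree a. \<iota> (coeff a i) * x ^ i)"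
proof -
  have "degree (map_poly \<iota> a) = degree a"
    by (simp add: degree_map_poly iota_eq_0_iff)
  thus ?thesis by (simp add: ev_def poly_altdef coeff_map_poly iota_zero)
qed

lemma Fq_linear_ev: "Fq_linear (\<lambda>a. ev \<iota> a x)"
  unfolding ev_altdef by (rule Fq_linear_coeff_sum)

lemma Fq_linear_carlitz_module: "Fq_linear (\<lambda>a. carlitz_module \<iota> \<theta> a x)"
  unfolding carlitz_module_def by (rule Fq_linear_coeff_sum)

lemma ev_add: "ev \<iota> (a + b) x = ev \<iota> a x + ev \<iota> b x"
  using Fq_linear_ev by (simp add: Fq_linear_def)

lemma ev_0: "ev \<iota> 0 x = 0"
  by (simp add: ev_def)

lemma ev_pCons: "ev \<iota> (pCons y w) x = \<iota> y + x * ev \<iota> w x"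
  by (simp add: ev_def map_poly_pCons iota_zero)

end

section \<open>Ultrametric sums and products\<close>

sublocale C_infinity \<subseteq> finite_field_embedding \<iota>
  by unfold_locales (fact iota_one iota_add iota_mult)+

context C_infinity
begin

lemma absval_nonneg: "absval (x :: 'a) \<ge> 0"
  by (simp add: absval_def)

lemma absval_eq_0_iff: "absval (x :: 'a) = 0 \<longleftrightarrow> x = 0"
  by (simp add: absval_def)

lemma absval_pos_iff: "0 < absval (x :: 'a) \<longleftrightarrow> x \<noteq> 0"
  by (simp add: absval_def)

lemma absval_0: "absval (0 :: 'a) = 0"
  by (simp add: absval_def)

lemma absval_1: "absval (1 :: 'a) = 1"
  using absval_mult[of 1 1] absval_eq_0_iff[of 1] by simp

lemma absval_power: "absval (x ^ n :: 'a) = absval x ^ n"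
  by (induction n) (simp_all add: absval_1 absval_mult)

lemma absval_divide: "absval (x / y :: 'a) = absval x / absval y"
proof (cases "y = 0")
  case False
  have "absval (x / y) * absval y = absval x" using False by (simp flip: absval_mult)
  thus ?thesis using False by (simp add: field_simps absval_eq_0_iff)
qed (simp add: absval_0)

lemma absval_minus_commute: "absval (x - y :: 'a) = absval (y - x)"
  by (metis dist_absval dist_commute)

lemma absval_minus: "absval (- x :: 'a) = absval x"
  using absval_minus_commute[of 0 x] by simp

lemma absval_diff_le: "absval (x - y :: 'a) \<le> max (absval x) (absval y)"
  using absval_ultrametric[of x "- y"] by (simp add: absval_minus)

lemma absval_add_eq:
  assumes "absval y < absval (x :: 'a)"
  shows "absval (x + y) = absval x"
  using assms absval_ultrametric[of x y] absval_diff_le[of "x + y" y] by auto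

lemma absval_sum_less:
  assumes "e > 0" "\<And>i. i \<in> S \<Longrightarrow> absval (f i :: 'a) < e"
  shows "absval (sum f S) < e"
  using assms(2)
proof (induction S rule: infinite_finite_induct)
  case (insert i S)
  hence "absval (f i) < e" "absval (sum f S) < e" by auto
  thus ?case using insert.hyps absval_ultrametric[of "f i" "sum f S"] by simp
qed (use \<open>e > 0\<close> in \<open>simp_all add: absval_0\<close>)

lemma absval_prod: "absval (prod f S :: 'a) = (\<Prod>i\<in>S. absval (f i))"
  by (induction S rule: infinite_finite_induct) (simp_all add: absval_1 absval_mult)

text \<open>The elements at distance less than \<open>e \<le> 1\<close> from 1 are closed under
  multiplication, since \<open>(1 - a) * P - 1 = (P - 1) * (1 - a) - a\<close> and
  \<open>1 - a\<close> has absolute value at most 1.\<close>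

lemma absval_prod_minus_one:
  assumes "0 < e" "e \<le> 1" "\<And>i. i \<in> S \<Longrightarrow> absval (f i :: 'a) < e"
  shows "absval ((\<Prod>i\<in>S. 1 - f i) - 1) < e"
  using assms(3)
proof (induction S rule: infinite_finite_induct)
  case (insert i S)
  define P where "P = (\<Prod>i\<in>S. 1 - f i)"
  have IH: "absval (P - 1) < e" "absval (f i) < e" using insert by (auto simp: P_def)
  have "absval (1 - f i) \<le> 1"
    using absval_diff_le[of 1 "f i"] IH \<open>e \<le> 1\<close> by (simp add: absval_1)
  hence "absval ((P - 1) * (1 - f i)) < e"
    using IH(1) mult_left_le[of "absval (1 - f i)" "absval (P - 1)"]
    by (simp add: absval_mult absval_nonneg)
  moreover have "(1 - f i) * P - 1 = (P - 1) * (1 - f i) - f i" by (simp add: algebra_simps)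
  ultimately show ?case
    using insert.hyps IH(2) absval_diff_le[of "(P - 1) * (1 - f i)" "f i"] by (simp flip: P_def)
qed (use \<open>e > 0\<close> in \<open>simp_all add: absval_0\<close>)

lemma tendsto_absval: "(f \<longlongrightarrow> (x :: 'a)) F \<Longrightarrow> ((\<lambda>i. absval (f i)) \<longlongrightarrow> absval x) F"
  unfolding absval_def by (intro tendsto_intros)

text \<open>Continuity of multiplication follows from multiplicativity of \<open>absval\<close>, by
  expanding \<open>a * b - x * y\<close> in \<open>a - x\<close> and \<open>b - y\<close>.\<close>

lemma tendsto_mult_absval:
  assumes "(f \<longlongrightarrow> (x :: 'a)) F" "(g \<longlongrightarrow> y) F"
  shows "((\<lambda>i. f i * g i) \<longlongrightarrow> x * y) F"
proof -
  have bound: "absval (a * b - x * y) \<le>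
    absval (a - x) * absval (b - y) + absval x * absval (b - y) + absval y * absval (a - x)" for a b
  proof -
    have "a * b - x * y = (a - x) * (b - y) + (x * (b - y) + y * (a - x))"
      by (simp add: algebra_simps)
    hence "absval (a * b - x * y) \<le> max (absval ((a - x) * (b - y)))
        (max (absval (x * (b - y))) (absval (y * (a - x))))"
      using absval_ultrametric[of "(a - x) * (b - y)" "x * (b - y) + y * (a - x)"]
        absval_ultrametric[of "x * (b - y)" "y * (a - x)"] by simp
    thus ?thesis unfolding absval_mult
      using absval_nonneg[of "a - x"] absval_nonneg[of "b - y"] absval_nonneg[of x] absval_nonneg[of y]
      by (smt (verit) mult_nonneg_nonneg)
  qed
  have lim: "((\<lambda>i. absval (f i - x)) \<longlongrightarrow> 0) F" "((\<lambda>i. absval (g i - y)) \<longlongrightarrow> 0) F"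
    using assms by (simp_all add: tendsto_dist_iff[of f] tendsto_dist_iff[of g] dist_absval)
  define h where "h i = absval (f i - x) * absval (g i - y) + absval x * absval (g i - y)
      + absval y * absval (f i - x)" for i
  have "(h \<longlongrightarrow> 0 * 0 + absval x * 0 + absval y * 0) F"
    unfolding h_def by (intro tendsto_add tendsto_mult tendsto_const lim)
  hence "(h \<longlongrightarrow> 0) F" by simp
  hence "((\<lambda>i. absval (f i * g i - x * y)) \<longlongrightarrow> 0) F"
    by (rule tendsto_sandwich[OF _ _ tendsto_const, rotated 2])
      (simp_all add: h_def bound absval_nonneg)
  thus ?thesis by (simp add: tendsto_dist_iff[of "\<lambda>i. f i * g i"] dist_absval)
qed

lemma tendsto_power_absval: "(f \<longlongrightarrow> (x :: 'a)) F \<Longrightarrow> ((\<lambda>i. f i ^ n) \<longlongrightarrow> x ^ n) F"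
  by (induction n) (simp_all add: tendsto_mult_absval)

text \<open>Terms tending to 0 suffice, as a finite sum of terms smaller than \<open>e\<close> is
  itself smaller than \<open>e\<close>.\<close>

lemma summable_on_ultrametric:
  fixes f :: "'i \<Rightarrow> 'a"
  assumes "\<And>e. e > 0 \<Longrightarrow> finite {i \<in> I. absval (f i) \<ge> e}"
  shows "f summable_on I"
proof -
  have "\<exists>L. (sum f \<longlongrightarrow> L) (finite_subsets_at_top I)"
  proof (rule convergent_finite_subsets_at_top)
    fix e :: real assume e: "e > 0"
    define F0 where "F0 = {i \<in> I. absval (f i) \<ge> e}"
    have "dist (sum f F) (sum f F0) < e" if F: "finite F" "F0 \<subseteq> F" "F \<subseteq> I" for F
    proof -
      have "sum f F - sum f F0 = sum f (F - F0)" using F by (simp add: sum_diff)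
      thus ?thesis using F e by (auto simp: dist_absval F0_def intro!: absval_sum_less)
    qed
    thus "\<exists>F0. finite F0 \<and> F0 \<subseteq> I \<and>
        (\<forall>F. finite F \<longrightarrow> F0 \<subseteq> F \<longrightarrow> F \<subseteq> I \<longrightarrow> dist (sum f F) (sum f F0) < e)"
      using assms[OF e] by (intro exI[of _ F0]) (auto simp: F0_def)
  qed
  thus ?thesis by (simp add: summable_on_def has_sum_def)
qed

text \<open>Only the finitely many factors indexed by \<open>F1\<close> can exceed 1 in absolute
  value, so \<open>C\<close> bounds every finite product containing them; adjoining factors close to
  1 then changes the product little.\<close>

lemma convergent_prod_ultrametric:
  fixes f :: "'i \<Rightarrow> 'a"
  assumes fin: "\<And>e. e > 0 \<Longrightarrow> finite {i \<in> I. absval (f i) \<ge> e}"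
  shows "\<exists>L. ((\<lambda>F. \<Prod>i\<in>F. 1 - f i) \<longlongrightarrow> L) (finite_subsets_at_top I)"
proof (rule convergent_finite_subsets_at_top)
  fix e :: real assume e: "e > 0"
  define F1 where "F1 = {i \<in> I. absval (f i) \<ge> 1}"
  define C where "C = absval (\<Prod>i\<in>F1. 1 - f i)"
  \<comment> \<open>Dividing by \<open>C + 1\<close> is safe for \<open>C = 0\<close> and still
    gives \<open>e' * C < e\<close>. The cap 1 ensures \<open>F1 \<subseteq> F0\<close>.\<close>
  define e' where "e' = min 1 (e / (C + 1))"
  have C: "C \<ge> 0" by (simp add: C_def absval_nonneg)
  have e': "0 < e'" "e' \<le> 1" using e C by (auto simp: e'_def)
  define F0 where "F0 = {i \<in> I. absval (f i) \<ge> e'}"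
  have F0: "finite F0" "F1 \<subseteq> F0" using fin e' by (auto simp: F0_def F1_def)
  have "absval (\<Prod>i\<in>F0 - F1. 1 - f i) \<le> 1"
    unfolding absval_prod
  proof (intro prod_le_1)
    fix i assume "i \<in> F0 - F1"
    hence "absval (f i) < 1" by (auto simp: F0_def F1_def)
    thus "0 \<le> absval (1 - f i) \<and> absval (1 - f i) \<le> 1"
      using absval_diff_le[of 1 "f i"] by (simp add: absval_nonneg absval_1)
  qed
  moreover have "(\<Prod>i\<in>F0. 1 - f i) = (\<Prod>i\<in>F0 - F1. 1 - f i) * (\<Prod>i\<in>F1. 1 - f i)"
    by (rule prod.subset_diff) (use F0 in auto)
  ultimately have C_ge: "absval (\<Prod>i\<in>F0. 1 - f i) \<le> C"
    using mult_right_mono[OF _ C, of _ 1] by (simp add: absval_mult C_def)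
  have "dist (\<Prod>i\<in>F. 1 - f i) (\<Prod>i\<in>F0. 1 - f i) < e" if F: "finite F" "F0 \<subseteq> F" "F \<subseteq> I" for F
  proof -
    have "(\<Prod>i\<in>F. 1 - f i) = (\<Prod>i\<in>F - F0. 1 - f i) * (\<Prod>i\<in>F0. 1 - f i)"
      by (rule prod.subset_diff) (use F in auto)
    hence eq: "dist (\<Prod>i\<in>F. 1 - f i) (\<Prod>i\<in>F0. 1 - f i)
        = absval ((\<Prod>i\<in>F - F0. 1 - f i) - 1) * absval (\<Prod>i\<in>F0. 1 - f i)"
      by (simp add: dist_absval algebra_simps flip: absval_mult)
    have "absval ((\<Prod>i\<in>F - F0. 1 - f i) - 1) < e'"
      by (rule absval_prod_minus_one[OF e']) (use F in \<open>auto simp: F0_def\<close>)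
    hence "dist (\<Prod>i\<in>F. 1 - f i) (\<Prod>i\<in>F0. 1 - f i) \<le> e' * C"
      unfolding eq using e' C_ge by (intro mult_mono) (auto simp: absval_nonneg)
    also have "\<dots> \<le> e / (C + 1) * C" using C by (intro mult_right_mono) (auto simp: e'_def)
    also have "\<dots> < e" using C e by (simp add: field_simps)
    finally show ?thesis .
  qed
  thus "\<exists>F0. finite F0 \<and> F0 \<subseteq> I \<and>
      (\<forall>F. finite F \<longrightarrow> F0 \<subseteq> F \<longrightarrow> F \<subseteq> I \<longrightarrow> dist (\<Prod>i\<in>F. 1 - f i) (\<Prod>i\<in>F0. 1 - f i) < e)"
    using F0 by (intro exI[of _ F0]) (auto simp: F0_def)
qed

section \<open>Sizes of polynomial values and a lower bound for the lattice exponential\<close>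

lemma absval_iota:
  assumes "y \<noteq> 0"
  shows "absval (\<iota> y) = 1"
proof -
  have "absval (\<iota> y) ^ (CARD('f) - 1) = 1"
    using power_q_minus_one[OF assms] by (simp flip: absval_power iota_power add: iota_one absval_1)
  thus ?thesis
    using q_ge_2 absval_nonneg power_eq_imp_eq_base[of "absval (\<iota> y)" "CARD('f) - 1" 1] by simp
qed

text \<open>The part divisible by \<theta> has absolute value at least q > 1 and so strictly
  dominates the constant coefficient; an ultrametric sum has the size of its strictly largest
  summand.\<close>

lemma absval_ev_theta:
  assumes "a \<noteq> 0"
  shows "absval (ev \<iota> a \<theta>) = real CARD('f) ^ degree a"
  using assms
proof (induction a)
  case (pCons y w)
  show ?case
  proof (cases "w = 0")
    case True
    thus ?thesis using pCons by (simp add: ev_pCons ev_0 absval_iota)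
  next
    case False
    hence *: "absval (\<theta> * ev \<iota> w \<theta>) = real CARD('f) ^ Suc (degree w)"
      using pCons by (simp add: absval_mult absval_theta)
    have "absval (\<iota> y) \<le> 1"
      by (cases "y = 0") (simp_all add: iota_zero absval_0 absval_iota)
    also have "1 < real CARD('f) ^ Suc (degree w)"
      using q_ge_2 by (intro one_less_power) auto
    finally have "absval (\<iota> y) < absval (\<theta> * ev \<iota> w \<theta>)" by (simp add: *)
    from absval_add_eq[OF this] show ?thesis using False * by (simp add: ev_pCons add.commute)
  qed
qed simp

text \<open>Coefficients have absolute value at most 1, and a base of at least 1 makes the top power
  bound the lower ones.\<close>

lemma absval_ev_le: "absval (ev \<iota> a x) \<le> max 1 (absval x) ^ degree a"
proof (induction a)
  case (pCons y w)
  define T where "T = max 1 (absval x)"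
  have T: "T \<ge> 1" by (simp add: T_def)
  have y: "absval (\<iota> y) \<le> 1"
    by (cases "y = 0") (simp_all add: iota_zero absval_0 absval_iota)
  show ?case
  proof (cases "w = 0")
    case True
    thus ?thesis using y by (simp add: ev_pCons ev_0)
  next
    case False
    have "absval x * absval (ev \<iota> w x) \<le> T * T ^ degree w"
      using pCons.IH T by (intro mult_mono) (auto simp: T_def absval_nonneg)
    moreover have "1 \<le> T ^ Suc (degree w)" using T by (rule one_le_power)
    ultimately show ?thesis
      using absval_ultrametric[of "\<iota> y" "x * ev \<iota> w x"] y False
      by (simp add: ev_pCons absval_mult flip: T_def)
  qed
qed (simp add: ev_0 absval_0)

text \<open>Up to a constant factor the partial product is \<open>\<Prod>\<^bsub>deg a \<le> n\<^esub> (w - a)\<close>, which does not change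
  when \<open>w\<close> is translated by a polynomial of degree at most \<open>n\<close>. Hence \<open>w\<close> may be assumed to be
  nearest to \<open>0\<close>, in which case \<open>\<bar>w - a\<bar> \<ge> max \<bar>w\<bar> \<bar>a\<bar>\<close>.\<close>
lemma absval_partial_lattice_product_ge:
  assumes far: "\<And>a. absval (w - ev \<iota> a \<theta>) \<ge> \<rho> * real CARD('f) ^ d"
    and "\<rho> \<ge> 1" "d \<le> n"
  shows "absval (w * (\<Prod>a\<in>{a. degree a \<le> n} - {0}. 1 - w / ev \<iota> a \<theta>)) \<ge> \<rho> ^ (CARD('f) ^ Suc d)"
proof -
  define V where "V = {a :: 'f poly. degree a \<le> n}"
  have V: "finite V" "0 \<in> V" by (simp_all add: V_def finite_degree_le)
  obtain a0 where a0: "a0 \<in> V" "\<And>a. a \<in> V \<Longrightarrow> absval (w - ev \<iota> a0 \<theta>) \<le> absval (w - ev \<iota> a \<theta>)"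
    using ex_is_arg_min_if_finite[of V "\<lambda>a. absval (w - ev \<iota> a \<theta>)"] V
    unfolding is_arg_min_def by (metis empty_iff not_le)
  define w' where "w' = w - ev \<iota> a0 \<theta>"
  \<comment> \<open>These are the factors of the product for the translated point \<open>w'\<close>;
    the index 0 contributes the absolute value of \<open>w'\<close> itself.\<close>
  define k where "k a = (if a = 0 then absval w' else absval (w' - ev \<iota> a \<theta>) / absval (ev \<iota> a \<theta>))" for a
  have q: "real CARD('f) \<ge> 1" using q_ge_2 by simp
  have w'_le: "absval w' \<le> absval (w' - ev \<iota> a \<theta>)" if "a \<in> V" for a
  proof -
    have "a0 + a \<in> V" using that a0(1) by (auto simp: V_def intro: degree_add_le)
    from a0(2)[OF this] show ?thesis by (simp add: w'_def ev_add algebra_simps)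
  qed
  have w'_ge: "\<rho> * real CARD('f) ^ d \<le> absval w'" unfolding w'_def by (rule far)
  have ev_pos: "absval (ev \<iota> a \<theta>) > 0" if "a \<noteq> 0" for a
    using q_ge_2 that by (simp add: absval_ev_theta)
  have k_ge: "(if degree a \<le> d then \<rho> else 1) \<le> k a" if a: "a \<in> V" for a
  proof (cases "a = 0")
    case True
    have "\<rho> * 1 \<le> \<rho> * real CARD('f) ^ d" using \<open>\<rho> \<ge> 1\<close> q by (intro mult_left_mono) auto
    thus ?thesis using True w'_ge by (simp add: k_def)
  next
    case False
    \<comment> \<open>Since \<open>w'\<close> is nearest to 0, the maximum is the second entry, so
      no factor with \<open>a \<noteq> 0\<close> is below 1.\<close>
    have "absval (ev \<iota> a \<theta>) \<le> max (absval w') (absval (w' - ev \<iota> a \<theta>))"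
      using absval_diff_le[of w' "w' - ev \<iota> a \<theta>"] by simp
    hence "1 \<le> k a" using w'_le[OF a] ev_pos[OF False] False by (simp add: k_def)
    moreover have "\<rho> \<le> k a" if "degree a \<le> d"
    proof -
      have "\<rho> * absval (ev \<iota> a \<theta>) \<le> \<rho> * real CARD('f) ^ d"
        using that \<open>\<rho> \<ge> 1\<close> q False by (simp add: absval_ev_theta power_increasing)
      also have "\<dots> \<le> absval (w' - ev \<iota> a \<theta>)" using w'_ge w'_le[OF a] by simp
      finally show ?thesis using ev_pos[OF False] False by (simp add: k_def field_simps)
    qed
    ultimately show ?thesis by simp
  qed
  \<comment> \<open>The exponent is the number of polynomials of degree at most \<open>d\<close>,
    each of which contributes a factor of at least \<open>\<rho>\<close>; the remaining factors are
    bounded below by 1.\<close>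
  have "\<rho> ^ (CARD('f) ^ Suc d) = (\<Prod>a\<in>{a :: 'f poly. degree a \<le> d}. \<rho>)"
    by (simp only: prod_constant card_degree_le)
  also have "\<dots> = (\<Prod>a\<in>V. if degree a \<le> d then \<rho> else 1)"
    using \<open>d \<le> n\<close> V by (intro prod.mono_neutral_cong_left) (auto simp: V_def)
  also have "\<dots> \<le> (\<Prod>a\<in>V. k a)"
    using k_ge \<open>\<rho> \<ge> 1\<close> by (intro prod_mono) auto
  also have "\<dots> = (\<Prod>a\<in>V. absval (w' - ev \<iota> a \<theta>)) / (\<Prod>a\<in>V - {0}. absval (ev \<iota> a \<theta>))"
    using V by (simp add: prod.remove[of V 0] k_def ev_0 prod_dividef)
  also have "(\<Prod>a\<in>V. absval (w' - ev \<iota> a \<theta>)) = (\<Prod>a\<in>V. absval (w - ev \<iota> (a0 + a) \<theta>))"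
    by (simp add: w'_def ev_add algebra_simps)
  also have "\<dots> = (\<Prod>a\<in>V. absval (w - ev \<iota> a \<theta>))"
    by (rule prod.reindex_bij_witness[of _ "\<lambda>a. a - a0" "\<lambda>a. a0 + a"])
      (use a0(1) in \<open>auto simp: V_def intro: degree_add_le degree_diff_le\<close>)
  also have "\<dots> / (\<Prod>a\<in>V - {0}. absval (ev \<iota> a \<theta>))
      = absval w * (\<Prod>a\<in>V - {0}. absval (w - ev \<iota> a \<theta>) / absval (ev \<iota> a \<theta>))"
    using V by (simp add: prod.remove[of V 0] ev_0 prod_dividef)
  also have "(\<Prod>a\<in>V - {0}. absval (w - ev \<iota> a \<theta>) / absval (ev \<iota> a \<theta>))
      = (\<Prod>a\<in>V - {0}. absval (1 - w / ev \<iota> a \<theta>))"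
  proof (intro prod.cong refl)
    fix a assume "a \<in> V - {0}"
    hence "ev \<iota> a \<theta> \<noteq> 0" using ev_pos[of a] by (auto simp: absval_0)
    hence "1 - w / ev \<iota> a \<theta> = (ev \<iota> a \<theta> - w) / ev \<iota> a \<theta>" by (simp add: field_simps)
    thus "absval (w - ev \<iota> a \<theta>) / absval (ev \<iota> a \<theta>) = absval (1 - w / ev \<iota> a \<theta>)"
      by (simp add: absval_divide absval_minus_commute)
  qed
  finally show ?thesis by (simp add: absval_mult absval_prod V_def)
qed

text \<open>The bound for the products over degree at most \<open>n\<close> is uniform in
  \<open>n \<ge> d\<close> and survives in the limit. Convergence comes first, so that
  \<open>Lim\<close> in \<open>lattice_exp\<close> denotes an actual limit.\<close>

lemma absval_lattice_exp_ge:
  assumes far: "\<And>a. absval (w - ev \<iota> a \<theta>) \<ge> \<rho> * real CARD('f) ^ d"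
    and "\<rho> \<ge> 1" "\<pi> \<noteq> 0"
  shows "absval (lattice_exp (scaled_A \<iota> \<theta> \<pi>) (\<pi> * w)) \<ge> absval \<pi> * \<rho> ^ (CARD('f) ^ Suc d)"
proof -
  define \<Lambda> where "\<Lambda> = scaled_A \<iota> \<theta> \<pi> - {0}"
  define g where "g a = \<pi> * ev \<iota> a \<theta>" for a
  define X where "X n = g ` ({a. degree a \<le> n} - {0})" for n
  have q: "real CARD('f) > 1" using q_ge_2 by simp
  have ev_nz: "ev \<iota> a \<theta> \<noteq> 0" if "a \<noteq> 0" for a
    using absval_ev_theta[OF that] q by (auto simp: absval_0)
  have g_0: "g a = 0 \<longleftrightarrow> a = 0" for a
    using ev_nz[of a] \<open>\<pi> \<noteq> 0\<close> by (auto simp: g_def ev_0)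
  have \<Lambda>_eq: "\<Lambda> = g ` (UNIV - {0})"
    unfolding \<Lambda>_def scaled_A_def using g_0 by (auto simp flip: g_def)
  have inj: "inj g"
  proof (rule injI)
    fix a b assume "g a = g b"
    moreover have "g a = g (a - b) + g b" by (simp add: g_def flip: distrib_left ev_add)
    ultimately show "a = b" using g_0[of "a - b"] by simp
  qed
  have fin: "finite {l \<in> \<Lambda>. absval (\<pi> * w / l) \<ge> e}" if "e > 0" for e
  proof -
    obtain n where n: "absval w / e < real CARD('f) ^ n" using real_arch_pow[OF q] by blast
    have "{l \<in> \<Lambda>. absval (\<pi> * w / l) \<ge> e} \<subseteq> X n"
    proof safe
      fix l assume l: "l \<in> \<Lambda>" "absval (\<pi> * w / l) \<ge> e"
      then obtain a where a: "a \<noteq> 0" "l = g a" by (auto simp: \<Lambda>_eq)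
      have "\<pi> * w / l = w / ev \<iota> a \<theta>" using a \<open>\<pi> \<noteq> 0\<close> by (simp add: g_def)
      hence "e \<le> absval w / real CARD('f) ^ degree a"
        using l a by (simp add: absval_divide absval_ev_theta)
      hence "real CARD('f) ^ degree a \<le> absval w / e" using that q by (simp add: field_simps)
      hence "real CARD('f) ^ degree a < real CARD('f) ^ n" using n by simp
      hence "degree a < n" using q by (simp add: power_strict_increasing_iff)
      thus "l \<in> X n" using a by (auto simp: X_def)
    qed
    thus ?thesis by (rule finite_subset) (simp add: X_def finite_degree_le)
  qed
  obtain L where L: "((\<lambda>F. \<Prod>l\<in>F. 1 - \<pi> * w / l) \<longlongrightarrow> L) (finite_subsets_at_top \<Lambda>)"
    using convergent_prod_ultrametric[OF fin] by blast
  have exp_eq: "lattice_exp (scaled_A \<iota> \<theta> \<pi>) (\<pi> * w) = \<pi> * w * L"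
    unfolding lattice_exp_def using tendsto_Lim[OF _ L] by (simp flip: \<Lambda>_def)
  have "filterlim X (finite_subsets_at_top \<Lambda>) sequentially"
    by (rule filterlim_exhaustion_finite_subsets_at_top)
      (auto simp: X_def \<Lambda>_eq finite_degree_le incseq_def)
  hence "(\<lambda>n. \<Prod>l\<in>X n. 1 - \<pi> * w / l) \<longlonglongrightarrow> L"
    using L by (rule filterlim_compose[rotated])
  hence lim: "(\<lambda>n. absval (\<pi> * w * (\<Prod>l\<in>X n. 1 - \<pi> * w / l))) \<longlonglongrightarrow> absval (\<pi> * w * L)"
    by (intro tendsto_absval tendsto_mult_absval tendsto_const)
  have "absval \<pi> * \<rho> ^ (CARD('f) ^ Suc d) \<le> absval (\<pi> * w * (\<Prod>l\<in>X n. 1 - \<pi> * w / l))"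
    if "n \<ge> d" for n
  proof -
    have "(\<Prod>l\<in>X n. 1 - \<pi> * w / l) = (\<Prod>a\<in>{a. degree a \<le> n} - {0}. 1 - w / ev \<iota> a \<theta>)"
      unfolding X_def using \<open>\<pi> \<noteq> 0\<close> inj
      by (subst prod.reindex) (auto simp: g_def intro: inj_on_subset)
    thus ?thesis
      using absval_partial_lattice_product_ge[OF far \<open>\<rho> \<ge> 1\<close> that]
      by (simp add: mult.assoc absval_mult[of \<pi>] absval_nonneg mult_left_mono del: power_Suc)
  qed
  thus ?thesis unfolding exp_eq
    by (intro tendsto_lowerbound[OF lim] eventually_sequentiallyI[of d]) auto
qed

section \<open>Decay of the terms and passage to the limit\<close>

lemma tendsto_partial_sums_A_plus:
  assumes "(f has_sum s) A_plus"
  shows "(\<lambda>n. sum f (monic_below n)) \<longlonglongrightarrow> s"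
proof -
  have "filterlim monic_below (finite_subsets_at_top A_plus) sequentially"
    by (rule filterlim_exhaustion_finite_subsets_at_top)
      (use finite_monic_below in \<open>auto simp: incseq_def monic_below_def A_plus_def\<close>)
  thus ?thesis using assms unfolding has_sum_def by (rule filterlim_compose[rotated])
qed

text \<open>The quotient of the two polynomial values lies in \<open>K_inf\<close>; clearing its
  denominator yields the power of q. This provides the hypothesis \<open>far\<close> above with
  \<open>\<rho> = imag_abs \<iota> \<theta> z\<close> and \<open>d = degree c\<close>.\<close>

lemma imag_abs_scale_le:
  assumes "c \<noteq> 0"
  shows "imag_abs \<iota> \<theta> z * real CARD('f) ^ degree c \<le> absval (ev \<iota> c \<theta> * z - ev \<iota> a \<theta>)"
proof -
  have nz: "ev \<iota> c \<theta> \<noteq> 0" using absval_ev_theta[OF assms] q_ge_2 by (auto simp: absval_0)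
  have "ev \<iota> a \<theta> / ev \<iota> c \<theta> \<in> K_inf \<iota> \<theta>"
    unfolding K_inf_def rational_functions_def using assms by (intro subsetD[OF closure_subset]) blast
  hence "imag_abs \<iota> \<theta> z \<le> absval (z - ev \<iota> a \<theta> / ev \<iota> c \<theta>)"
    unfolding imag_abs_def by (intro cINF_lower) (auto intro!: bdd_belowI2[where m = 0] absval_nonneg)
  hence "imag_abs \<iota> \<theta> z * absval (ev \<iota> c \<theta>) \<le> absval ((z - ev \<iota> a \<theta> / ev \<iota> c \<theta>) * ev \<iota> c \<theta>)"
    unfolding absval_mult by (rule mult_right_mono) (rule absval_nonneg)
  moreover have "(z - ev \<iota> a \<theta> / ev \<iota> c \<theta>) * ev \<iota> c \<theta> = ev \<iota> c \<theta> * z - ev \<iota> a \<theta>"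
    using nz by (simp add: field_simps)
  ultimately show ?thesis by (simp add: absval_ev_theta[OF assms])
qed

lemma absval_lattice_exp_multiple_ge:
  assumes "imag_abs \<iota> \<theta> z > 1" "\<pi> \<noteq> 0" "c \<noteq> 0"
  shows "absval (lattice_exp (scaled_A \<iota> \<theta> \<pi>) (\<pi> * ev \<iota> c \<theta> * z))
    \<ge> absval \<pi> * imag_abs \<iota> \<theta> z ^ (CARD('f) ^ Suc (degree c))"
  using absval_lattice_exp_ge[OF imag_abs_scale_le[OF \<open>c \<noteq> 0\<close>], of z \<pi>] assms
  by (simp add: mult.assoc)

text \<open>The values of \<open>c\<close> at \<open>t\<close> grow at most exponentially in the
  degree, while \<open>u\<close> decays doubly exponentially.\<close>

lemma finite_large_terms:
  assumes "imag_abs \<iota> \<theta> z > 1" "\<pi> \<noteq> 0" "e > 0"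
  shows "finite {c \<in> A_plus. absval (ev \<iota> c t * u \<iota> \<theta> \<pi> c z) \<ge> e}"
proof -
  define \<rho> where "\<rho> = imag_abs \<iota> \<theta> z"
  define T where "T = max 1 (absval t)"
  have \<rho>: "\<rho> > 1" using assms by (simp add: \<rho>_def)
  have T: "T \<ge> 1" by (simp add: T_def)
  have \<pi>: "absval \<pi> > 0" using assms by (simp add: absval_pos_iff)
  have "ln \<rho> > 0" using \<rho> by simp
  \<comment> \<open>The exponent \<open>2 ^ d\<close>, a lower bound for \<open>q ^ (d + 1)\<close>,
    is already large enough: on the logarithmic scale it outgrows the linear term.\<close>
  hence "(\<lambda>d. exp (real d * ln T - 2 ^ d * ln \<rho>)) \<longlonglongrightarrow> 0" by real_asymp
  moreover have "exp (real d * ln T - 2 ^ d * ln \<rho>) = T ^ d / \<rho> ^ (2 ^ d)" for d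
    using \<rho> T exp_of_nat_mult[of "2 ^ d" "ln \<rho>"] by (simp add: exp_diff exp_of_nat_mult)
  ultimately have "(\<lambda>d. T ^ d / \<rho> ^ (2 ^ d)) \<longlonglongrightarrow> 0" by simp
  hence "\<forall>\<^sub>F d in sequentially. T ^ d / \<rho> ^ (2 ^ d) < e * absval \<pi>"
    by (rule order_tendstoD) (use \<open>e > 0\<close> \<pi> in simp)
  then obtain N where N: "\<And>d. d \<ge> N \<Longrightarrow> T ^ d / \<rho> ^ (2 ^ d) < e * absval \<pi>"
    by (auto simp: eventually_sequentially)
  have "degree c \<le> N" if c: "c \<in> A_plus" "absval (ev \<iota> c t * u \<iota> \<theta> \<pi> c z) \<ge> e" for c
  proof (rule ccontr)
    assume "\<not> degree c \<le> N"
    define d where "d = degree c"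
    have "N \<le> d" using \<open>\<not> degree c \<le> N\<close> by (simp add: d_def)
    have "c \<noteq> 0" using c by (auto simp: A_plus_def)
    have "2 ^ d \<le> CARD('f) ^ Suc d"
      using power_mono[OF q_ge_2, of d] power_increasing[of d "Suc d" "CARD('f)"] q_ge_2 by linarith
    hence "absval \<pi> * \<rho> ^ (2 ^ d) \<le> absval \<pi> * \<rho> ^ (CARD('f) ^ Suc d)"
      using \<rho> \<pi> by (intro mult_left_mono power_increasing) auto
    also have "\<dots> \<le> absval (lattice_exp (scaled_A \<iota> \<theta> \<pi>) (\<pi> * ev \<iota> c \<theta> * z))"
      using absval_lattice_exp_multiple_ge[OF assms(1,2) \<open>c \<noteq> 0\<close>] by (simp add: \<rho>_def d_def)
    finally have "absval (u \<iota> \<theta> \<pi> c z) \<le> 1 / (absval \<pi> * \<rho> ^ (2 ^ d))"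
      using \<pi> \<rho> by (simp add: u_def absval_divide absval_1 frac_le)
    hence "absval (ev \<iota> c t * u \<iota> \<theta> \<pi> c z) \<le> T ^ d * (1 / (absval \<pi> * \<rho> ^ (2 ^ d)))"
      unfolding absval_mult using T absval_ev_le[of c t]
      by (intro mult_mono) (auto simp: T_def d_def absval_nonneg)
    also have "\<dots> = (T ^ d / \<rho> ^ (2 ^ d)) / absval \<pi>" by simp
    also have "\<dots> < e" using N[OF \<open>N \<le> d\<close>] by (simp only: pos_divide_less_eq[OF \<pi>])
    finally show False using c by simp
  qed
  hence "{c \<in> A_plus. absval (ev \<iota> c t * u \<iota> \<theta> \<pi> c z) \<ge> e} \<subseteq> {c. degree c \<le> N}" by blast
  thus ?thesis by (rule finite_subset) (rule finite_degree_le)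
qed

lemma deformed_E_power:
  assumes period: "carlitz_period \<iota> \<theta> \<pi>" and l: "1 \<le> l" "l \<le> CARD('f)"
    and z: "imag_abs \<iota> \<theta> z > 1"
  shows "((\<lambda>c. ev \<iota> c t ^ l * u \<iota> \<theta> \<pi> c z ^ l) has_sum deformed_E \<iota> \<theta> \<pi> z t ^ l) A_plus"
proof -
  define f where "f c = ev \<iota> c t * u \<iota> \<theta> \<pi> c z" for c
  define x where "x = lattice_exp (scaled_A \<iota> \<theta> \<pi>) (\<pi> * z)"
  have \<pi>: "\<pi> \<noteq> 0" using period by (simp add: carlitz_period_def)
  have exp_eq: "lattice_exp (scaled_A \<iota> \<theta> \<pi>) (\<pi> * ev \<iota> c \<theta> * z) = carlitz_module \<iota> \<theta> c x" for c
    using period unfolding carlitz_period_def x_def by (metis mult.assoc mult.commute)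
  have fin: "finite {c \<in> A_plus. absval (f c) \<ge> e}" if "e > 0" for e
    unfolding f_def using finite_large_terms[OF z \<pi> that] .
  have "finite {c \<in> A_plus. absval (f c ^ l) \<ge> e}" if "e > 0" for e
  proof (rule finite_subset)
    \<comment> \<open>Below 1, raising to a power \<open>l \<ge> 1\<close> does not increase the
      absolute value; hence the threshold \<open>min 1 e\<close>.\<close>
    show "{c \<in> A_plus. absval (f c ^ l) \<ge> e} \<subseteq> {c \<in> A_plus. absval (f c) \<ge> min 1 e}"
    proof safe
      fix c assume e: "e \<le> absval (f c ^ l)"
      show "min 1 e \<le> absval (f c)"
      proof (rule ccontr)
        assume *: "\<not> ?thesis"
        hence "absval (f c) ^ l \<le> absval (f c) ^ 1"
          using l absval_nonneg by (intro power_decreasing) auto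
        thus False using * e by (simp add: absval_power)
      qed
    qed
    show "finite {c \<in> A_plus. absval (f c) \<ge> min 1 e}" using fin that by simp
  qed
  hence "(\<lambda>c. f c ^ l) summable_on A_plus" by (rule summable_on_ultrametric)
  then obtain S where S: "((\<lambda>c. f c ^ l) has_sum S) A_plus" by (auto simp: summable_on_def)
  \<comment> \<open>Summability rules out the default value 0 of the infinite sum in
    \<open>deformed_E\<close>.\<close>
  have "f summable_on A_plus" using fin by (rule summable_on_ultrametric)
  hence "(f has_sum deformed_E \<iota> \<theta> \<pi> z t) A_plus"
    unfolding deformed_E_def f_def[symmetric] by (rule has_sum_infsum)
  hence "(\<lambda>n. sum f (monic_below n) ^ l) \<longlonglongrightarrow> deformed_E \<iota> \<theta> \<pi> z t ^ l"
    by (rule tendsto_power_absval[OF tendsto_partial_sums_A_plus])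
  moreover have "sum f (monic_below n) ^ l = (\<Sum>c\<in>monic_below n. f c ^ l)" for n
  proof -
    \<comment> \<open>The lower bound for the exponential also provides the injectivity of the
      denominator needed in the finite identity.\<close>
    have "carlitz_module \<iota> \<theta> c x \<noteq> 0" if "c \<noteq> 0" for c
    proof -
      have "0 < absval \<pi> * imag_abs \<iota> \<theta> z ^ (CARD('f) ^ Suc (degree c))"
        using z absval_pos_iff[of \<pi>] \<pi> by simp
      thus ?thesis using absval_lattice_exp_multiple_ge[OF z \<pi> that] by (auto simp: exp_eq absval_0)
    qed
    thus ?thesis
      using sum_linear_ratio_power[OF Fq_linear_ev Fq_linear_carlitz_module _ l, of n \<theta> x t]
      by (simp add: f_def u_def exp_eq)
  qed
  ultimately have "S = deformed_E \<iota> \<theta> \<pi> z t ^ l"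
    using tendsto_partial_sums_A_plus[OF S] by (auto intro: LIMSEQ_unique)
  thus ?thesis using S by (simp add: f_def power_mult_distrib)
qed

end

theorem theorem4p4:
  fixes \<iota> :: "'f::{field,finite} \<Rightarrow> 'a::{field,complete_space}"
    and \<theta> \<pi> z t :: 'a
    and l :: nat
  assumes "C_infinity \<iota> \<theta>"
    and "carlitz_period \<iota> \<theta> \<pi>"
    and "1 \<le> l" and "l \<le> CARD('f)"
    and "z \<in> Omega1 \<iota> \<theta>"
    and "absval t < real CARD('f) ^ CARD('f)"
  shows "((\<lambda>c. ev \<iota> c t ^ l * u \<iota> \<theta> \<pi> c z ^ l) has_sum deformed_E \<iota> \<theta> \<pi> z t ^ l) A_plus"
  using C_infinity.deformed_E_power[OF assms(1-4)] assms(5) by (simp add: Omega1_def)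

end
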